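(* Let $(X,\mathcal F)$ be a (finite) hypergraph with maximum degree $\Delta$. Let $0<\varepsilon\leq 1$, let $0<\lambda<1$ be such that $\frac{-\ln\lambda}{1-\lambda}\leq 1+\frac{\varepsilon}{2}$, and set $$f:=\left\lceil\frac{2(1+\ln\Delta)}{\varepsilon(1-\lambda)}\right\rceil .$$ Let $\tau_f$ denote the $f$-fold transversal number and $\tau^{\ast}$ the fractional transversal number of $(X,\mathcal F)$. Then $$\tau^{\ast}\leq \frac{\tau_f}{f}\leq \tau^{\ast}(1+\varepsilon).$$ Moreover, if $\lambda$ is rational and $A$ is the $f$-fold transversal produced by the $\lambda$-weighted greedy algorithm (described in the context), then the function $w:X\to\mathbb R$, $w(x)=\frac{1}{f}\cdot(\text{multiplicity of } x \text{ in } A)$, is a fractional transversal of $(X,\mathcal F)$ with $\tau^{\ast}\le\sum_{x\in X}w(x)\leq \tau^{\ast}(1+\varepsilon)$.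
   Context: A hypergraph is a pair $(X,\mathcal F)$, where $X$ is a finite set (the vertices) and $\mathcal F\subseteq 2^X$ is a family of subsets of $X$ (the edges). It is tacitly assumed that $\mathcal F$ is nonempty and that every edge is nonempty. The maximum degree $\Delta$ is the maximum number of edges a vertex is contained in. An $f$-fold transversal of $(X,\mathcal F)$ is a multiset $A$ of elements of $X$ such that each $F\in\mathcal F$ contains at least $f$ elements of $A$, counted with multiplicity. The $f$-fold transversal number $\tau_f$ is the minimum cardinality (with multiplicity) of an $f$-fold transversal. A fractional transversal is a function $w:X\to[0,1]$ with $\sum_{x\in F}w(x)\ge 1$ for all $F\in\mathcal F$; the fractional transversal number is $\tau^{\ast}=\inf\{\sum_{x\in X}w(x) : w \text{ is a fractional transversal}\}$. The $\lambda$-weighted greedy algorithm: vertices are picked one by one, with repetition allowed. At any stage, for $F\in\mathcal F$ let $k(F)$ be the number of vertices picked so far (with multiplicity) that lie in $F$; initially $k\equiv 0$. The value of a vertex $x$ at this stage is $v_k(x)=\sum_{F\in\mathcal F,\ x\in F,\ k(F)<f}\lambda^{k(F)}$. At each step one picks a vertex of largest value (ties broken arbitrarily). The algorithm stops once $k(F)\ge f$ for every $F\in\mathcal F$; its output is the multiset of picked vertices. *)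

theory Defs
  imports Complex_Main "HOL-Library.Multiset"
begin

definition hypergraph :: "'a set \<Rightarrow> 'a set set \<Rightarrow> bool" where
  "hypergraph X \<F> \<longleftrightarrow> finite X \<and> \<F> \<subseteq> Pow X \<and> \<F> \<noteq> {} \<and> {} \<notin> \<F>"

definition max_degree :: "'a set \<Rightarrow> 'a set set \<Rightarrow> nat" where
  "max_degree X \<F> = Max ((\<lambda>x. card {F \<in> \<F>. x \<in> F}) ` X)"

definition hits :: "'a multiset \<Rightarrow> 'a set \<Rightarrow> nat" where
  "hits A F = size (filter_mset (\<lambda>x. x \<in> F) A)"

definition fold_transversal :: "'a set \<Rightarrow> 'a set set \<Rightarrow> nat \<Rightarrow> 'a multiset \<Rightarrow> bool" where
  "fold_transversal X \<F> f A \<longleftrightarrow> set_mset A \<subseteq> X \<and> (\<forall>F\<in>\<F>. f \<le> hits A F)"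

definition fold_transversal_number :: "'a set \<Rightarrow> 'a set set \<Rightarrow> nat \<Rightarrow> nat" where
  "fold_transversal_number X \<F> f = (LEAST n. \<exists>A. fold_transversal X \<F> f A \<and> size A = n)"

definition fractional_transversal :: "'a set \<Rightarrow> 'a set set \<Rightarrow> ('a \<Rightarrow> real) \<Rightarrow> bool" where
  "fractional_transversal X \<F> w \<longleftrightarrow>
     (\<forall>x\<in>X. 0 \<le> w x \<and> w x \<le> 1) \<and> (\<forall>F\<in>\<F>. 1 \<le> (\<Sum>x\<in>F. w x))"

definition fractional_transversal_number :: "'a set \<Rightarrow> 'a set set \<Rightarrow> real" where
  "fractional_transversal_number X \<F> = Inf {\<Sum>x\<in>X. w x | w. fractional_transversal X \<F> w}"

text \<open>The state of the greedy algorithm is the multiset \<open>A\<close> of vertices picked so far; it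
  determines the counters via \<open>k(F) = hits A F\<close>.\<close>

definition greedy_value :: "'a set set \<Rightarrow> real \<Rightarrow> nat \<Rightarrow> 'a multiset \<Rightarrow> 'a \<Rightarrow> real" where
  "greedy_value \<F> l f A x = (\<Sum>F\<in>{F \<in> \<F>. x \<in> F \<and> hits A F < f}. l ^ hits A F)"

text \<open>Since ties may be broken arbitrarily, the algorithm is a relation: \<open>greedy_state\<close>
  describes the states reachable under any tie-breaking, and \<open>greedy_output\<close> the possible
  outputs.\<close>

inductive greedy_state :: "'a set \<Rightarrow> 'a set set \<Rightarrow> real \<Rightarrow> nat \<Rightarrow> 'a multiset \<Rightarrow> bool"
  for X \<F> l f where
  start: "greedy_state X \<F> l f {#}"
| pick: "greedy_state X \<F> l f A \<Longrightarrow> \<exists>F\<in>\<F>. hits A F < f \<Longrightarrow>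
    x \<in> X \<Longrightarrow> \<forall>y\<in>X. greedy_value \<F> l f A y \<le> greedy_value \<F> l f A x \<Longrightarrow>
    greedy_state X \<F> l f (add_mset x A)"

definition greedy_output :: "'a set \<Rightarrow> 'a set set \<Rightarrow> real \<Rightarrow> nat \<Rightarrow> 'a multiset \<Rightarrow> bool" where
  "greedy_output X \<F> l f A \<longleftrightarrow> greedy_state X \<F> l f A \<and> (\<forall>F\<in>\<F>. f \<le> hits A F)"

lemma greedy_output_fold_transversal:
  assumes "greedy_output X \<F> l f A"
  shows "fold_transversal X \<F> f A"
proof -
  have "greedy_state X \<F> l f A \<Longrightarrow> set_mset A \<subseteq> X"
    by (induction rule: greedy_state.induct) auto
  then show ?thesis
    using assms by (auto simp: greedy_output_def fold_transversal_def)
qed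

text \<open>The next two lemmas say that every run terminates with an output: the number of picks is
  bounded, and a run that has not stopped can be continued.\<close>

lemma greedy_state_size:
  assumes H: "hypergraph X \<F>" and l: "0 < l" and A: "greedy_state X \<F> l f A"
  shows "size A \<le> f * card \<F>"
proof -
  have finF: "finite \<F>"
    using H unfolding hypergraph_def by (auto intro: finite_subset)
  have hits_add: "hits (add_mset x A) F = hits A F + (if x \<in> F then 1 else 0)" for x A and F :: "'a set"
    by (simp add: hits_def)
  have "size A \<le> (\<Sum>F\<in>\<F>. min f (hits A F))"
    using A
  proof (induction rule: greedy_state.induct)
    case start
    show ?case by simp
  next
    case (pick A x)
    obtain F where F: "F \<in> \<F>" "hits A F < f" using pick.hyps by blast
    have "F \<noteq> {}" "F \<subseteq> X"
      using F(1) H unfolding hypergraph_def by auto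
    then obtain y where y: "y \<in> F" "y \<in> X" by blast
    have "0 < greedy_value \<F> l f A y"
      unfolding greedy_value_def
    proof (rule sum_pos)
      show "finite {F \<in> \<F>. y \<in> F \<and> hits A F < f}" using finF by simp
      show "{F \<in> \<F>. y \<in> F \<and> hits A F < f} \<noteq> {}" using F y by blast
    qed (simp add: l)
    then have "0 < greedy_value \<F> l f A x"
      using pick.hyps(4) y(2) less_le_trans by blast
    then obtain G where G: "G \<in> \<F>" "x \<in> G" "hits A G < f"
    proof -
      have "{F \<in> \<F>. x \<in> F \<and> hits A F < f} \<noteq> {}"
      proof
        assume "{F \<in> \<F>. x \<in> F \<and> hits A F < f} = {}"
        then show False
          using \<open>0 < greedy_value \<F> l f A x\<close> unfolding greedy_value_def by (simp only: sum.empty)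
      qed
      then show thesis using that by blast
    qed
    have "(\<Sum>F\<in>\<F>. min f (hits A F)) < (\<Sum>F\<in>\<F>. min f (hits (add_mset x A) F))"
    proof (rule sum_strict_mono_ex1)
      show "finite \<F>" by (fact finF)
      show "\<forall>F\<in>\<F>. min f (hits A F) \<le> min f (hits (add_mset x A) F)"
        by (simp add: hits_add min.coboundedI2)
      show "\<exists>F\<in>\<F>. min f (hits A F) < min f (hits (add_mset x A) F)"
        using G by (intro bexI[of _ G]) (simp_all add: hits_add)
    qed
    then show ?case using pick.IH by simp
  qed
  also have "\<dots> \<le> (\<Sum>F\<in>\<F>. f)" by (rule sum_mono) simp
  finally show ?thesis by (simp add: mult.commute)
qed

lemma greedy_state_extend:
  assumes "hypergraph X \<F>" "greedy_state X \<F> l f A" "\<not> greedy_output X \<F> l f A"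
  shows "\<exists>x\<in>X. greedy_state X \<F> l f (add_mset x A)"
proof -
  have fin: "finite X" and ne: "X \<noteq> {}"
    using assms(1) unfolding hypergraph_def by auto
  let ?V = "greedy_value \<F> l f A ` X"
  have "Max ?V \<in> ?V" using fin ne by (intro Max_in) auto
  then obtain x where x: "x \<in> X" "greedy_value \<F> l f A x = Max ?V" by auto
  have "\<forall>y\<in>X. greedy_value \<F> l f A y \<le> greedy_value \<F> l f A x"
    using fin x(2) by simp
  moreover have "\<exists>F\<in>\<F>. hits A F < f"
    using assms(2,3) by (auto simp: greedy_output_def not_le)
  ultimately show ?thesis
    using greedy_state.pick[OF assms(2)] x(1) by blast
qed

end

theory Submission
  imports Defs
begin

text \<open>
  Put \<open>\<Psi> = \<Sum>\<^sub>F \<Sum>\<^bsub>k(F) \<le> i < f\<^esub> \<lambda>\<^sup>i\<close>. Picking \<open>x\<close> lowers \<open>\<Psi>\<close> by exactly the value of \<open>x\<close>. For a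
  fractional transversal of total weight \<open>W\<close>, averaging shows that the largest value is at
  least \<open>(1 - \<lambda>) \<Psi> / W\<close>; it is also at least \<open>b = \<lambda>\<^bsup>f - 1\<^esup>\<close> while some edge is
  active. Hence \<open>\<integral> ds / max b ((1 - \<lambda>) s / W)\<close>, taken from \<open>0\<close> to \<open>\<Psi>\<close>, drops by at least one
  in each step. As \<open>\<Psi> \<le> \<Delta> W / (1 - \<lambda>)\<close> at the start, the number of steps is at most
  \<open>W (1 + ln \<Delta> - (f - 1) ln \<lambda>) / (1 - \<lambda>)\<close>, which is at most \<open>f W (1 + \<epsilon>)\<close> by the choice of
  \<open>f\<close> and \<open>\<lambda>\<close>.
\<close>

section \<open>Elementary facts on edges, multiplicities and degrees\<close>

lemma hypergraph_finite:
  assumes "hypergraph X \<F>"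
  shows "finite X" "finite \<F>" "\<F> \<noteq> {}" "X \<noteq> {}"
    "\<And>F. F \<in> \<F> \<Longrightarrow> F \<subseteq> X" "\<And>F. F \<in> \<F> \<Longrightarrow> F \<noteq> {}" "\<And>F. F \<in> \<F> \<Longrightarrow> finite F"
proof -
  show X: "finite X" and "\<F> \<noteq> {}" "X \<noteq> {}"
    and sub: "\<And>F. F \<in> \<F> \<Longrightarrow> F \<subseteq> X" and "\<And>F. F \<in> \<F> \<Longrightarrow> F \<noteq> {}"
    using assms unfolding hypergraph_def by auto
  show "finite F" if "F \<in> \<F>" for F using sub[OF that] X by (rule finite_subset)
  show "finite \<F>" using assms X unfolding hypergraph_def by (blast intro: finite_subset)
qed

lemma hits_empty [simp]: "hits {#} F = 0"
  by (simp add: hits_def)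

lemma hits_add_mset [simp]: "hits (add_mset x A) F = (if x \<in> F then Suc (hits A F) else hits A F)"
  by (simp add: hits_def)

lemma size_eq_sum_count:
  assumes "finite X" "set_mset A \<subseteq> X"
  shows "size A = (\<Sum>x\<in>X. count A x)"
  unfolding size_multiset_overloaded_eq using assms
  by (intro sum.mono_neutral_left) (auto simp: not_in_iff)

lemma hits_eq_sum_count:
  assumes "finite F"
  shows "hits A F = (\<Sum>x\<in>F. count A x)"
proof -
  have "hits A F = (\<Sum>x\<in>F. count (filter_mset (\<lambda>x. x \<in> F) A) x)"
    unfolding hits_def using assms by (intro size_eq_sum_count) auto
  then show ?thesis by simp
qed

lemma max_degree_upper:
  assumes "finite X" "x \<in> X"
  shows "card {F \<in> \<F>. x \<in> F} \<le> max_degree X \<F>"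
  unfolding max_degree_def using assms by simp

lemma max_degree_pos:
  assumes H: "hypergraph X \<F>"
  shows "1 \<le> max_degree X \<F>"
proof -
  note hg = hypergraph_finite[OF H]
  obtain F where F: "F \<in> \<F>" using hg(3) by blast
  obtain x where x: "x \<in> F" using hg(6)[OF F] by blast
  have "{F \<in> \<F>. x \<in> F} \<noteq> {}" using F x by blast
  then have "1 \<le> card {F \<in> \<F>. x \<in> F}"
    using hg(2) by (simp add: Suc_leI card_gt_0_iff)
  also have "\<dots> \<le> max_degree X \<F>"
    using hg(5)[OF F] x by (intro max_degree_upper hg(1)) auto
  finally show ?thesis .
qed

section \<open>Fractional transversals and averaging over them\<close>

lemma fractional_transversal_one:
  assumes "hypergraph X \<F>"
  shows "fractional_transversal X \<F> (\<lambda>_. 1)"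
proof -
  have "Suc 0 \<le> card F" if "F \<in> \<F>" for F
    using hypergraph_finite(6,7)[OF assms that] by (simp add: Suc_leI card_gt_0_iff)
  then show ?thesis by (auto simp: fractional_transversal_def)
qed

lemma fractional_transversal_number_le:
  assumes "fractional_transversal X \<F> w"
  shows "fractional_transversal_number X \<F> \<le> (\<Sum>x\<in>X. w x)"
  unfolding fractional_transversal_number_def
proof (rule cInf_lower)
  show "(\<Sum>x\<in>X. w x) \<in> {\<Sum>x\<in>X. w x | w. fractional_transversal X \<F> w}"
    using assms by blast
  show "bdd_below {\<Sum>x\<in>X. w x | w. fractional_transversal X \<F> w}"
    by (rule bdd_belowI[of _ 0]) (auto simp: fractional_transversal_def intro!: sum_nonneg)
qed

lemma fractional_transversal_number_greatest:
  assumes "hypergraph X \<F>"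
    and "\<And>w. fractional_transversal X \<F> w \<Longrightarrow> c \<le> (\<Sum>x\<in>X. w x)"
  shows "c \<le> fractional_transversal_number X \<F>"
  unfolding fractional_transversal_number_def
proof (rule cInf_greatest)
  show "{\<Sum>x\<in>X. w x | w. fractional_transversal X \<F> w} \<noteq> {}"
    using fractional_transversal_one[OF assms(1)] by blast
  fix c' assume "c' \<in> {\<Sum>x\<in>X. w x | w. fractional_transversal X \<F> w}"
  then obtain w where "fractional_transversal X \<F> w" "c' = (\<Sum>x\<in>X. w x)" by blast
  then show "c \<le> c'" using assms(2) by simp
qed

lemma fractional_transversal_weight_ge_1:
  assumes "hypergraph X \<F>" "fractional_transversal X \<F> w"
  shows "1 \<le> (\<Sum>x\<in>X. w x)"
proof -
  note hg = hypergraph_finite[OF assms(1)]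
  obtain F where F: "F \<in> \<F>" using hg(3) by blast
  have "1 \<le> (\<Sum>x\<in>F. w x)" using F assms(2) by (simp add: fractional_transversal_def)
  also have "\<dots> \<le> (\<Sum>x\<in>X. w x)"
    using hg(1) hg(5)[OF F] assms(2) by (intro sum_mono2) (auto simp: fractional_transversal_def)
  finally show ?thesis .
qed

text \<open>Weak linear programming duality by double counting: each edge has weight at least 1
  under \<open>w\<close>, and after swapping the sums vertex \<open>x\<close> carries
  \<open>w x\<close> times its load, which is at most \<open>M\<close>. It is applied to the
  constant 1 and to the powers of \<open>l\<close> on the active edges.\<close>

lemma fractional_transversal_averaging:
  fixes g :: "'a set \<Rightarrow> real"
  assumes H: "hypergraph X \<F>" and w: "fractional_transversal X \<F> w" and G: "\<G> \<subseteq> \<F>"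
    and g: "\<And>F. F \<in> \<G> \<Longrightarrow> 0 \<le> g F"
    and M: "\<And>x. x \<in> X \<Longrightarrow> (\<Sum>F\<in>{F \<in> \<G>. x \<in> F}. g F) \<le> M"
  shows "(\<Sum>F\<in>\<G>. g F) \<le> M * (\<Sum>x\<in>X. w x)"
proof -
  note hg = hypergraph_finite[OF H]
  have finG: "finite \<G>" using hg(2) G finite_subset by blast
  have "(\<Sum>F\<in>\<G>. g F) \<le> (\<Sum>F\<in>\<G>. g F * (\<Sum>x\<in>F. w x))"
  proof (rule sum_mono)
    fix F assume F: "F \<in> \<G>"
    then have "1 \<le> (\<Sum>x\<in>F. w x)" using w G by (auto simp: fractional_transversal_def)
    then show "g F \<le> g F * (\<Sum>x\<in>F. w x)" using mult_left_mono[OF _ g[OF F]] by fastforce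
  qed
  also have "\<dots> = (\<Sum>F\<in>\<G>. \<Sum>x\<in>{x \<in> X. x \<in> F}. w x * g F)"
  proof (rule sum.cong)
    fix F assume "F \<in> \<G>"
    then have "{x \<in> X. x \<in> F} = F" using hg(5) G by blast
    then show "g F * (\<Sum>x\<in>F. w x) = (\<Sum>x\<in>{x \<in> X. x \<in> F}. w x * g F)"
      by (simp add: sum_distrib_left mult.commute)
  qed simp
  also have "\<dots> = (\<Sum>x\<in>X. \<Sum>F\<in>{F \<in> \<G>. x \<in> F}. w x * g F)"
    using finG hg(1) by (rule sum.swap_restrict)
  also have "\<dots> = (\<Sum>x\<in>X. w x * (\<Sum>F\<in>{F \<in> \<G>. x \<in> F}. g F))"
    by (simp add: sum_distrib_left)
  also have "\<dots> \<le> (\<Sum>x\<in>X. w x * M)"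
    using w M by (intro sum_mono mult_left_mono) (auto simp: fractional_transversal_def)
  finally show ?thesis by (simp add: sum_distrib_left mult.commute)
qed

lemma card_edges_le:
  assumes "hypergraph X \<F>" "fractional_transversal X \<F> w"
  shows "real (card \<F>) \<le> real (max_degree X \<F>) * (\<Sum>x\<in>X. w x)"
  using fractional_transversal_averaging[OF assms, of \<F> "\<lambda>_. 1" "real (max_degree X \<F>)"]
    max_degree_upper[OF hypergraph_finite(1)[OF assms(1)]] by simp

section \<open>The potential and lower bounds for the largest value\<close>

definition greedy_potential :: "'a set set \<Rightarrow> real \<Rightarrow> nat \<Rightarrow> 'a multiset \<Rightarrow> real" where
  "greedy_potential \<F> l f A = (\<Sum>F\<in>\<F>. \<Sum>i\<in>{hits A F..<f}. l ^ i)"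

lemma greedy_potential_nonneg: "0 \<le> l \<Longrightarrow> 0 \<le> greedy_potential \<F> l f A"
  unfolding greedy_potential_def by (intro sum_nonneg) simp

text \<open>A pick of \<open>x\<close> deletes the first term \<open>l ^ hits A F\<close> from the
  inner sum of every active edge through \<open>x\<close>. Edges already hit \<open>f\<close> times
  have an empty sum and are not affected.\<close>

lemma greedy_potential_add_mset:
  assumes "finite \<F>"
  shows "greedy_potential \<F> l f (add_mset x A) = greedy_potential \<F> l f A - greedy_value \<F> l f A x"
proof -
  have "greedy_value \<F> l f A x = (\<Sum>F\<in>\<F>. if x \<in> F \<and> hits A F < f then l ^ hits A F else 0)"
    unfolding greedy_value_def using assms by (rule sum.inter_filter)
  then have "greedy_potential \<F> l f (add_mset x A) + greedy_value \<F> l f A x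
      = (\<Sum>F\<in>\<F>. (\<Sum>i\<in>{hits (add_mset x A) F..<f}. l ^ i)
          + (if x \<in> F \<and> hits A F < f then l ^ hits A F else 0))"
    by (simp only: greedy_potential_def sum.distrib)
  also have "\<dots> = greedy_potential \<F> l f A"
    unfolding greedy_potential_def by (intro sum.cong) (auto simp: sum.atLeast_Suc_lessThan)
  finally show ?thesis by simp
qed

text \<open>The product telescopes to \<open>l ^ k - l ^ f\<close> when \<open>k < f\<close>, and
  the last power is dropped.\<close>

lemma sum_powers_le:
  assumes "0 < (l::real)" "l < 1"
  shows "(1 - l) * (\<Sum>i\<in>{k..<f}. l ^ i) \<le> (if k < f then l ^ k else 0)"
proof (cases "k < f")
  case True
  have "(1 - l) * (\<Sum>i\<in>{k..<f}. l ^ i) = l ^ k - l ^ f"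
  proof -
    from True obtain n where "f = Suc n" "k \<le> n" by (cases f) auto
    then show ?thesis
      using sum_gp_multiplied[of k n l] by (simp add: atLeastLessThanSuc_atLeastAtMost)
  qed
  then show ?thesis using True assms by simp
qed simp

lemma greedy_potential_le:
  assumes "finite \<F>" "0 < l" "l < 1"
  shows "(1 - l) * greedy_potential \<F> l f A \<le> (\<Sum>F\<in>{F \<in> \<F>. hits A F < f}. l ^ hits A F)"
proof -
  have "(1 - l) * greedy_potential \<F> l f A \<le> (\<Sum>F\<in>\<F>. if hits A F < f then l ^ hits A F else 0)"
    unfolding greedy_potential_def sum_distrib_left[of "1 - l" _ \<F>]
    by (intro sum_mono sum_powers_le assms)
  also have "\<dots> = (\<Sum>F\<in>{F \<in> \<F>. hits A F < f}. l ^ hits A F)"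
    using assms(1) by (rule sum.inter_filter[symmetric])
  finally show ?thesis .
qed

text \<open>Averaging with the largest value as \<open>M\<close>: the load of a vertex under the
  weights \<open>l ^ hits A F\<close> of active edges is exactly its greedy value.\<close>

lemma greedy_value_ge:
  assumes H: "hypergraph X \<F>" and w: "fractional_transversal X \<F> w" and l: "0 < l" "l < 1"
    and max: "\<forall>y\<in>X. greedy_value \<F> l f A y \<le> greedy_value \<F> l f A x"
  shows "(1 - l) * greedy_potential \<F> l f A \<le> greedy_value \<F> l f A x * (\<Sum>x\<in>X. w x)"
proof -
  have "(\<Sum>F\<in>{F \<in> \<F>. hits A F < f}. l ^ hits A F) \<le> greedy_value \<F> l f A x * (\<Sum>x\<in>X. w x)"
  proof (rule fractional_transversal_averaging[OF H w])
    fix y assume "y \<in> X"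
    moreover have "{F \<in> {F \<in> \<F>. hits A F < f}. y \<in> F} = {F \<in> \<F>. y \<in> F \<and> hits A F < f}" by blast
    ultimately show "(\<Sum>F\<in>{F \<in> {F \<in> \<F>. hits A F < f}. y \<in> F}. l ^ hits A F) \<le> greedy_value \<F> l f A x"
      using max by (simp add: greedy_value_def)
  qed (use l in auto)
  then show ?thesis using greedy_potential_le[OF hypergraph_finite(2)[OF H] l, of f A] by linarith
qed

text \<open>An active edge has at most \<open>f - 1\<close> hits, so it alone gives each of its
  vertices at least this value. This bound takes over when the potential has become small.\<close>

lemma greedy_value_ge_power:
  assumes H: "hypergraph X \<F>" and l: "0 < l" "l < 1"
    and active: "\<exists>F\<in>\<F>. hits A F < f"
    and max: "\<forall>y\<in>X. greedy_value \<F> l f A y \<le> greedy_value \<F> l f A x"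
  shows "l ^ (f - 1) \<le> greedy_value \<F> l f A x"
proof -
  note hg = hypergraph_finite[OF H]
  obtain F where F: "F \<in> \<F>" "hits A F < f" using active by blast
  obtain y where y: "y \<in> F" using hg(6)[OF F(1)] by blast
  have "l ^ (f - 1) \<le> l ^ hits A F" using F l by (intro power_decreasing) auto
  also have "\<dots> \<le> greedy_value \<F> l f A y"
    unfolding greedy_value_def using F y l hg(2) by (intro member_le_sum) auto
  also have "\<dots> \<le> greedy_value \<F> l f A x" using max y hg(5)[OF F(1)] by blast
  finally show ?thesis .
qed

section \<open>The logarithmic bound on the length of a greedy run\<close>

text \<open>The integral of \<open>1 / max 1 s\<close> from \<open>0\<close> to \<open>u\<close>.\<close>

definition lin_log :: "real \<Rightarrow> real" where
  "lin_log u = (if u \<le> 1 then u else 1 + ln u)"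

text \<open>The integrand is nonincreasing, so on \<open>[v, u]\<close> it is at least its value at
  \<open>u\<close>; equivalently, the concave \<open>lin_log\<close> lies below its tangent at
  \<open>u\<close>.\<close>

lemma lin_log_decrease:
  assumes "v \<le> u"
  shows "lin_log v + (u - v) / max 1 u \<le> lin_log u"
proof (cases "u \<le> 1")
  case True
  then show ?thesis using assms by (simp add: lin_log_def)
next
  case False
  then have u: "1 < u" by simp
  show ?thesis
  proof (cases "v \<le> 1")
    case True
    \<comment> \<open>This reduces the case to \<open>v = 1\<close>, where the inequality is
      \<open>1 - 1 / u <= ln u\<close>.\<close>
    have "v * (1 - 1 / u) \<le> 1 * (1 - 1 / u)" using True u by (intro mult_right_mono) auto
    moreover have "ln (1 / u) \<le> 1 / u - 1" using u by (intro ln_le_minus_one) simp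
    then have "1 - 1 / u \<le> ln u" using u by (simp add: ln_div)
    ultimately have "v + (1 - v / u) \<le> 1 + ln u" by (simp add: right_diff_distrib)
    then show ?thesis using u True by (simp add: lin_log_def diff_divide_distrib)
  next
    case False
    have "ln (v / u) \<le> v / u - 1" using u False by (intro ln_le_minus_one) simp
    then show ?thesis using u False by (simp add: lin_log_def ln_div diff_divide_distrib)
  qed
qed

lemma lin_log_le:
  assumes "u \<le> y" "1 \<le> y"
  shows "lin_log u \<le> 1 + ln y"
  using assms by (auto simp: lin_log_def intro: order_trans)

text \<open>The potential is rescaled to \<open>u\<close> so that the two lower bounds for the
  largest value agree exactly at \<open>u A = 1\<close>. Each pick then lowers \<open>u\<close> by
  at least \<open>c * max 1 (u A)\<close>, hence \<open>lin_log\<close> by at least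
  \<open>c\<close>.\<close>

lemma greedy_state_lin_log:
  fixes w :: "'a \<Rightarrow> real"
  assumes H: "hypergraph X \<F>" and w: "fractional_transversal X \<F> w" and l: "0 < l" "l < 1"
    and A: "greedy_state X \<F> l f A"
  defines "c \<equiv> (1 - l) / (\<Sum>x\<in>X. w x)"
  defines "u \<equiv> \<lambda>A. c * greedy_potential \<F> l f A / l ^ (f - 1)"
  shows "c * size A + lin_log (u A) \<le> lin_log (u {#})"
  using A
proof (induction rule: greedy_state.induct)
  case start
  then show ?case by simp
next
  case (pick A x)
  define m where "m = greedy_value \<F> l f A x"
  define b where "b = l ^ (f - 1)"
  have W: "1 \<le> (\<Sum>x\<in>X. w x)" by (rule fractional_transversal_weight_ge_1[OF H w])
  have c: "0 < c" using W l by (simp add: c_def)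
  have b: "0 < b" using l by (simp add: b_def)
  have m1: "b \<le> m"
    unfolding b_def m_def by (rule greedy_value_ge_power[OF H l pick.hyps(2,4)])
  have "c * greedy_potential \<F> l f A \<le> m"
    using greedy_value_ge[OF H w l pick.hyps(4)] W by (simp add: c_def m_def field_simps)
  then have "u A \<le> m / b"
    using b by (simp add: u_def b_def divide_right_mono)
  then have m2: "max 1 (u A) \<le> m / b" using m1 b by simp
  have step: "u (add_mset x A) = u A - c * (m / b)"
    by (simp add: u_def greedy_potential_add_mset[OF hypergraph_finite(2)[OF H]] m_def b_def
        right_diff_distrib diff_divide_distrib)
  have "c * max 1 (u A) \<le> c * (m / b)" using m2 c by (intro mult_left_mono) auto
  then have "c \<le> (u A - u (add_mset x A)) / max 1 (u A)"
    unfolding step by (subst pos_le_divide_eq) auto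
  moreover have "0 \<le> c * (m / b)" using c b m1 by simp
  then have "lin_log (u (add_mset x A)) + (u A - u (add_mset x A)) / max 1 (u A) \<le> lin_log (u A)"
    using step by (intro lin_log_decrease) linarith
  ultimately show ?case using pick.IH by (simp add: algebra_simps)
qed

lemma greedy_state_size_le:
  assumes H: "hypergraph X \<F>" and w: "fractional_transversal X \<F> w" and l: "0 < l" "l < 1"
    and A: "greedy_state X \<F> l f A"
  shows "(1 - l) * size A
    \<le> (1 + ln (real (max_degree X \<F>)) + real (f - 1) * (- ln l)) * (\<Sum>x\<in>X. w x)"
proof -
  define W where "W = (\<Sum>x\<in>X. w x)"
  define D where "D = real (max_degree X \<F>)"
  define u where "u = (\<lambda>A. (1 - l) / W * greedy_potential \<F> l f A / l ^ (f - 1))"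
  have W: "1 \<le> W" unfolding W_def by (rule fractional_transversal_weight_ge_1[OF H w])
  have D: "1 \<le> D" using max_degree_pos[OF H] by (simp add: D_def)
  have "(1 - l) / W * size A + lin_log (u A) \<le> lin_log (u {#})"
    unfolding u_def W_def by (rule greedy_state_lin_log[OF H w l A])
  moreover have "0 \<le> u A"
    using l W by (simp add: u_def greedy_potential_nonneg)
  then have "0 \<le> lin_log (u A)" by (simp add: lin_log_def)
  moreover have "lin_log (u {#}) \<le> 1 + ln (D / l ^ (f - 1))"
  proof (rule lin_log_le)
    \<comment> \<open>Initially all counters are 0, so each edge contributes at most 1; for
      \<open>f = 0\<close> no edge is active.\<close>
    have "(1 - l) * greedy_potential \<F> l f {#} \<le> (\<Sum>F\<in>{F \<in> \<F>. 0 < f}. 1)"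
      using greedy_potential_le[OF hypergraph_finite(2)[OF H] l, of f "{#}"] by simp
    also have "\<dots> \<le> card \<F>" using card_mono[OF hypergraph_finite(2)[OF H]] by simp
    also have "\<dots> \<le> D * W" unfolding D_def W_def by (rule card_edges_le[OF H w])
    finally have "(1 - l) / W * greedy_potential \<F> l f {#} \<le> D" using W by (simp add: field_simps)
    then show "u {#} \<le> D / l ^ (f - 1)"
      using l unfolding u_def by (intro divide_right_mono) auto
    have "l ^ (f - 1) \<le> 1" using l by (intro power_le_one) auto
    then show "1 \<le> D / l ^ (f - 1)" using D l by (simp add: le_divide_eq)
  qed
  ultimately have "(1 - l) / W * size A \<le> 1 + ln (D / l ^ (f - 1))" by linarith
  also have "ln (D / l ^ (f - 1)) = ln D + real (f - 1) * (- ln l)"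
    using D l by (simp add: ln_div ln_realpow)
  finally show ?thesis using W by (simp add: W_def[symmetric] D_def[symmetric] field_simps)
qed

section \<open>Multiplicities in greedy runs and existence of an output\<close>

lemma greedy_state_count_le:
  assumes H: "hypergraph X \<F>" and l: "0 < l" "l < 1" and A: "greedy_state X \<F> l f A"
  shows "count A y \<le> f"
  using A
proof (induction rule: greedy_state.induct)
  case start
  then show ?case by simp
next
  case (pick A x)
  \<comment> \<open>After \<open>f\<close> picks of \<open>x\<close> every edge through
    \<open>x\<close> is satisfied, so \<open>x\<close> has value 0, whereas a largest value is
    positive while some edge is active.\<close>
  have "count A x < f"
  proof (rule ccontr)
    assume *: "\<not> count A x < f"
    have "f \<le> hits A F" if "F \<in> \<F>" "x \<in> F" for F
    proof -
      have "count A x \<le> (\<Sum>y\<in>F. count A y)"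
        using hypergraph_finite(7)[OF H] that by (intro member_le_sum) auto
      then show ?thesis using * hits_eq_sum_count[of F A] hypergraph_finite(7)[OF H] that by simp
    qed
    then have "{F \<in> \<F>. x \<in> F \<and> hits A F < f} = {}" by fastforce
    then have "greedy_value \<F> l f A x = 0" by (simp only: greedy_value_def sum.empty)
    moreover have "l ^ (f - 1) \<le> greedy_value \<F> l f A x"
      by (rule greedy_value_ge_power[OF H l pick.hyps(2,4)])
    moreover have "0 < l ^ (f - 1)" using l by simp
    ultimately show False by linarith
  qed
  then show ?case using pick.IH by auto
qed

text \<open>Without an output every state could be extended, giving states of every size against the
  bound \<open>f * card \<F>\<close>.\<close>

lemma greedy_output_exists:
  assumes H: "hypergraph X \<F>" and l: "0 < l"
  shows "\<exists>A. greedy_output X \<F> l f A"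
proof (rule ccontr)
  assume no: "\<nexists>A. greedy_output X \<F> l f A"
  have "\<exists>A. greedy_state X \<F> l f A \<and> size A = n" for n
  proof (induction n)
    case 0
    then show ?case using greedy_state.start by fastforce
  next
    case (Suc n)
    then show ?case using greedy_state_extend[OF H] no by (metis size_add_mset)
  qed
  then show False using greedy_state_size[OF H l] by (metis Suc_n_not_le_n)
qed

section \<open>From \<open>f\<close>-fold transversals to fractional ones\<close>

lemma fold_transversal_number_le:
  "fold_transversal X \<F> f A \<Longrightarrow> fold_transversal_number X \<F> f \<le> size A"
  unfolding fold_transversal_number_def by (rule Least_le) blast

lemma fold_transversal_number_attained:
  assumes "fold_transversal X \<F> f A"
  obtains B where "fold_transversal X \<F> f B" "size B = fold_transversal_number X \<F> f"
proof -
  have "\<exists>B. fold_transversal X \<F> f B \<and> size B = fold_transversal_number X \<F> f"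
    unfolding fold_transversal_number_def by (rule LeastI) (use assms in blast)
  then show thesis using that by blast
qed

text \<open>A multiplicity may exceed \<open>f\<close>, but a fractional transversal takes values at most \<open>1\<close>; hence
  the truncation.\<close>

lemma fractional_transversal_of_fold_transversal:
  assumes H: "hypergraph X \<F>" and A: "fold_transversal X \<F> f A" and f: "0 < f"
  shows "fractional_transversal X \<F> (\<lambda>x. min 1 (count A x / f))"
  unfolding fractional_transversal_def
proof (intro conjI ballI)
  fix F assume F: "F \<in> \<F>"
  have fin: "finite F" by (rule hypergraph_finite(7)[OF H F])
  show "1 \<le> (\<Sum>x\<in>F. min 1 (count A x / f))"
  \<comment> \<open>A vertex of multiplicity at least \<open>f\<close> alone gives \<open>F\<close>
    weight 1; if there is none, the truncation changes nothing on \<open>F\<close>.\<close>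
  proof (cases "\<exists>x\<in>F. f \<le> count A x")
    case True
    then obtain x where x: "x \<in> F" "f \<le> count A x" by blast
    then have "1 = min 1 (count A x / f)" using f by simp
    also have "\<dots> \<le> (\<Sum>x\<in>F. min 1 (count A x / f))"
      using x fin by (intro member_le_sum) auto
    finally show ?thesis .
  next
    case False
    have "real f \<le> hits A F" using A F by (simp add: fold_transversal_def)
    then have "1 \<le> hits A F / f" using f by simp
    also have "\<dots> = (\<Sum>x\<in>F. count A x / f)"
      by (simp add: hits_eq_sum_count[OF fin] sum_divide_distrib)
    also have "\<dots> = (\<Sum>x\<in>F. min 1 (count A x / f))"
      using False f by (intro sum.cong) (auto simp: min_def field_simps)
    finally show ?thesis by simp
  qed
qed auto

lemma fractional_transversal_number_le_fold:
  assumes H: "hypergraph X \<F>" and A: "fold_transversal X \<F> f A" and f: "0 < f"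
  shows "fractional_transversal_number X \<F> \<le> size A / f"
proof -
  have "fractional_transversal_number X \<F> \<le> (\<Sum>x\<in>X. min 1 (count A x / f))"
    by (intro fractional_transversal_number_le fractional_transversal_of_fold_transversal assms)
  also have "\<dots> \<le> (\<Sum>x\<in>X. count A x / f)" by (intro sum_mono) simp
  also have "\<dots> = size A / f"
    using A hypergraph_finite(1)[OF H]
    by (simp add: size_eq_sum_count[of X] fold_transversal_def sum_divide_distrib)
  finally show ?thesis .
qed

section \<open>Combining the estimates\<close>

theorem corollary1p3:
  fixes X :: "'a set" and \<F> :: "'a set set" and \<epsilon> l :: real and \<Delta> f :: nat
  assumes "hypergraph X \<F>"
    and "\<Delta> = max_degree X \<F>"
    and "0 < \<epsilon>" and "\<epsilon> \<le> 1"
    and "0 < l" and "l < 1"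
    and "- ln l / (1 - l) \<le> 1 + \<epsilon> / 2"
    and "f = nat \<lceil>2 * (1 + ln (real \<Delta>)) / (\<epsilon> * (1 - l))\<rceil>"
  shows "(fractional_transversal_number X \<F> \<le> real (fold_transversal_number X \<F> f) / real f \<and>
          real (fold_transversal_number X \<F> f) / real f
            \<le> fractional_transversal_number X \<F> * (1 + \<epsilon>)) \<and>
         (l \<in> \<rat> \<longrightarrow>
           (\<forall>A w. greedy_output X \<F> l f A \<longrightarrow> (\<forall>x\<in>X. w x = 1 / real f * real (count A x)) \<longrightarrow>
             fractional_transversal X \<F> w \<and>
             fractional_transversal_number X \<F> \<le> (\<Sum>x\<in>X. w x) \<and>
             (\<Sum>x\<in>X. w x) \<le> fractional_transversal_number X \<F> * (1 + \<epsilon>)))"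
proof -
  note H = assms(1) and l = assms(5,6)
  have lnD: "0 \<le> ln (real \<Delta>)"
    using max_degree_pos[OF H] assms(2) by simp
  have pos: "0 < \<epsilon> * (1 - l)" using assms(3) l by simp
  have "2 * (1 + ln (real \<Delta>)) / (\<epsilon> * (1 - l)) \<le> f"
    using assms(8) real_nat_ceiling_ge by simp
  \<comment> \<open>The choice of \<open>f\<close> lets the additive term 1 + ln \<Delta> use one
    half of \<epsilon>; the condition on \<open>l\<close> leaves the other half for the factor
    \<open>- ln l / (1 - l)\<close>.\<close>
  then have f1: "1 + ln (real \<Delta>) \<le> f * (1 - l) * (\<epsilon> / 2)"
    using pos by (simp add: field_simps)
  then have f: "0 < f" using lnD by (cases f) auto
  have lnl: "- ln l \<le> (1 + \<epsilon> / 2) * (1 - l)"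
    using assms(7) l by (subst (asm) pos_divide_le_eq) auto
  have size_bound: "size A / f \<le> fractional_transversal_number X \<F> * (1 + \<epsilon>)"
    if A: "greedy_output X \<F> l f A" for A
  proof -
    \<comment> \<open>The left side does not depend on \<open>w\<close>, so the bound passes to the
      infimum without an optimal \<open>w\<close>.\<close>
    have "size A / f / (1 + \<epsilon>) \<le> (\<Sum>x\<in>X. w x)" if w: "fractional_transversal X \<F> w" for w
    proof -
      have W: "1 \<le> (\<Sum>x\<in>X. w x)" by (rule fractional_transversal_weight_ge_1[OF H w])
      have "real (f - 1) * (- ln l) \<le> f * ((1 + \<epsilon> / 2) * (1 - l))"
        using lnl l by (intro mult_mono) auto
      moreover have "f * (1 + \<epsilon>) * (1 - l) = f * ((1 + \<epsilon> / 2) * (1 - l)) + f * (1 - l) * (\<epsilon> / 2)"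
        by (simp add: field_simps)
      ultimately have "1 + ln (real \<Delta>) + real (f - 1) * (- ln l) \<le> f * (1 + \<epsilon>) * (1 - l)"
        using f1 by linarith
      then have "(1 + ln (real \<Delta>) + real (f - 1) * (- ln l)) * (\<Sum>x\<in>X. w x)
          \<le> f * (1 + \<epsilon>) * (1 - l) * (\<Sum>x\<in>X. w x)"
        using W by (intro mult_right_mono) auto
      moreover have "(1 - l) * size A
          \<le> (1 + ln (real \<Delta>) + real (f - 1) * (- ln l)) * (\<Sum>x\<in>X. w x)"
        using greedy_state_size_le[OF H w l] A assms(2) by (simp add: greedy_output_def)
      ultimately have "(1 - l) * size A \<le> (1 - l) * (f * (1 + \<epsilon>) * (\<Sum>x\<in>X. w x))"
        by (simp add: ac_simps)
      then have "size A \<le> f * (1 + \<epsilon>) * (\<Sum>x\<in>X. w x)"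
        using l by (simp only: mult_le_cancel_left_pos diff_gt_0_iff_gt)
      then show ?thesis
        using f assms(3) by (simp add: divide_le_eq ac_simps)
    qed
    then have "size A / f / (1 + \<epsilon>) \<le> fractional_transversal_number X \<F>"
      by (rule fractional_transversal_number_greatest[OF H])
    then show ?thesis using assms(3) by (subst (asm) pos_divide_le_eq) auto
  qed
  \<comment> \<open>This output shows that the minimum defining the \<open>f\<close>-fold
    transversal number is attained, and its size bounds that minimum from above.\<close>
  obtain A where A: "greedy_output X \<F> l f A" using greedy_output_exists[OF H l(1)] by blast
  note A' = greedy_output_fold_transversal[OF A]
  obtain B where B: "fold_transversal X \<F> f B" "size B = fold_transversal_number X \<F> f"
    using fold_transversal_number_attained[OF A'] .
  have lower: "fractional_transversal_number X \<F> \<le> fold_transversal_number X \<F> f / f"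
    using fractional_transversal_number_le_fold[OF H B(1) f] B(2) by simp
  have "real (fold_transversal_number X \<F> f) / f \<le> size A / f"
    using fold_transversal_number_le[OF A'] by (intro divide_right_mono) auto
  then have upper: "real (fold_transversal_number X \<F> f) / f
      \<le> fractional_transversal_number X \<F> * (1 + \<epsilon>)"
    using size_bound[OF A] by linarith
  have "fractional_transversal X \<F> w \<and> fractional_transversal_number X \<F> \<le> (\<Sum>x\<in>X. w x) \<and>
      (\<Sum>x\<in>X. w x) \<le> fractional_transversal_number X \<F> * (1 + \<epsilon>)"
    if C: "greedy_output X \<F> l f C" and w: "\<forall>x\<in>X. w x = 1 / real f * real (count C x)" for C w
  proof -
    note C' = greedy_output_fold_transversal[OF C]
    \<comment> \<open>With multiplicities at most \<open>f\<close> the truncation is vacuous, so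
      \<open>w\<close> itself agrees on \<open>X\<close> with the truncated function.\<close>
    have "count C x \<le> f" for x
      using greedy_state_count_le[OF H l] C by (simp add: greedy_output_def)
    then have eq: "w x = min 1 (count C x / f)" if "x \<in> X" for x
      using w that f by (simp add: min_absorb2)
    have "(\<Sum>x\<in>F. w x) = (\<Sum>x\<in>F. min 1 (count C x / f))" if "F \<in> \<F>" for F
      using hypergraph_finite(5)[OF H that] eq by (intro sum.cong) auto
    then have ft: "fractional_transversal X \<F> w"
      using fractional_transversal_of_fold_transversal[OF H C' f] eq
      by (simp add: fractional_transversal_def)
    have "(\<Sum>x\<in>X. w x) = size C / f"
      using w C' hypergraph_finite(1)[OF H]
      by (simp add: size_eq_sum_count[of X] fold_transversal_def sum_divide_distrib)
    then show ?thesis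
      using ft fractional_transversal_number_le[OF ft] size_bound[OF C] by simp
  qed
  then show ?thesis using lower upper by blast
qed

end
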